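(* Let $\Upsilon=(\Phi,p)$ be a non-trivial, feasible, symmetric, balance-dominated and 1-essential CSP-model of arity $k$. Then \[ r_p(\Upsilon)\ge \frac{0.25}{\Omega_p(\Upsilon)},\qquad\text{where } \Omega_p(\Upsilon)=\mathbf E_{\varphi}\big[|I_\varphi|/|S_\varphi|\big].\]
   Context: A CSP-model of arity $k$ is $\Upsilon=(\Phi,p)$, $\Phi$ a set of functions $\{-1,1\}^k\to\{0,1\}$ (constraints), $p$ a probability distribution with support $\Phi$; $\mathbf E_\varphi$ is expectation over $\varphi\sim p$. $S_\varphi$ is the set of $x\in\{-1,1\}^k$ with $\varphi(x)=1$, $I_\varphi=\{-1,1\}^k\setminus S_\varphi$. Non-trivial: some $\varphi\in\Phi$ has $\varphi(1,\dots,1)=0$ and some has $\varphi(-1,\dots,-1)=0$. Feasible: for each $\varphi\in\Phi$ and each assignment of $k-1$ coordinates, at least one of the two values of the remaining coordinate gives $\varphi=1$. Symmetric: $\varphi(x)=\varphi(-x)$. Balance-dominated: for $\sigma$ with i.i.d. coordinates equal to $1$ w.p. $q$ and $-1$ otherwise, and $\varphi\sim p$, $\Pr(\varphi(\sigma)=1)$ is maximized at $q=1/2$. For $\sigma\in S_\varphi$, coordinate $i$ is essential if flipping it gives an element of $I_\varphi$; 1-essential: every $\varphi\in\Phi$ and $\sigma\in S_\varphi$ have at most one essential coordinate. For $Q\subseteq\{1,\dots,k\}$, $\hat\varphi_Q=2^{-k}\sum_{x}\varphi(x)\prod_{i\in Q}x_i$; $P_\varphi(\theta)=\sum_{Q}(\hat\varphi_Q/\hat\varphi_\emptyset)^2\theta^{|Q|}$;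 $\mathbf H(\theta)=-\frac{1+\theta}{2}\ln(1+\theta)-\frac{1-\theta}{2}\ln(1-\theta)$; $r_p(\Upsilon)=\inf_{\theta\in(0,1)}\frac{-\mathbf H(\theta)}{\sum_{\varphi\in\Phi}p(\varphi)\ln P_\varphi(\theta)}$. *)

theory Defs
  imports "HOL-Probability.Probability"
begin

text \<open>
  The cube \<open>{-1,1}\<^sup>k\<close> consists of real-valued functions on \<open>{1..k}\<close>, and a constraint is a
  function from the cube to \<open>{0,1}\<close>. Both are extensional (\<open>undefined\<close> outside their domain),
  so that equality in HOL is equality as functions on the domain.
\<close>

definition cube :: "nat \<Rightarrow> (nat \<Rightarrow> real) set" where
  "cube k = {1..k} \<rightarrow>\<^sub>E {-1, 1}"

type_synonym constraint = "(nat \<Rightarrow> real) \<Rightarrow> real"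

definition csp_model :: "nat \<Rightarrow> constraint set \<Rightarrow> constraint pmf \<Rightarrow> bool" where
  "csp_model k \<Phi> p \<longleftrightarrow> k \<ge> 1 \<and> \<Phi> \<subseteq> cube k \<rightarrow>\<^sub>E {0, 1} \<and> set_pmf p = \<Phi>"

definition sat_set :: "nat \<Rightarrow> constraint \<Rightarrow> (nat \<Rightarrow> real) set" where
  "sat_set k \<phi> = {x \<in> cube k. \<phi> x = 1}"

definition unsat_set :: "nat \<Rightarrow> constraint \<Rightarrow> (nat \<Rightarrow> real) set" where
  "unsat_set k \<phi> = cube k - sat_set k \<phi>"

definition nontrivial :: "nat \<Rightarrow> constraint set \<Rightarrow> bool" where
  "nontrivial k \<Phi> \<longleftrightarrow>
     (\<exists>\<phi>\<in>\<Phi>. \<phi> (\<lambda>i\<in>{1..k}. 1) = 0) \<and> (\<exists>\<phi>\<in>\<Phi>. \<phi> (\<lambda>i\<in>{1..k}. -1) = 0)"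

text \<open>
  An assignment of all coordinates but \<open>i\<close> is given by a point \<open>x\<close> of the cube whose value at \<open>i\<close>
  is overwritten.
\<close>

definition feasible :: "nat \<Rightarrow> constraint set \<Rightarrow> bool" where
  "feasible k \<Phi> \<longleftrightarrow>
     (\<forall>\<phi>\<in>\<Phi>. \<forall>i\<in>{1..k}. \<forall>x\<in>cube k. \<exists>s\<in>{-1, 1}. \<phi> (x(i := s)) = 1)"

definition symmetric :: "nat \<Rightarrow> constraint set \<Rightarrow> bool" where
  "symmetric k \<Phi> \<longleftrightarrow> (\<forall>\<phi>\<in>\<Phi>. \<forall>x\<in>cube k. \<phi> x = \<phi> (\<lambda>i\<in>{1..k}. - x i))"

definition biased_spin :: "real \<Rightarrow> real pmf" where
  "biased_spin q = map_pmf (\<lambda>b. if b then 1 else -1) (bernoulli_pmf q)"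

definition biased_cube :: "nat \<Rightarrow> real \<Rightarrow> (nat \<Rightarrow> real) pmf" where
  "biased_cube k q = Pi_pmf {1..k} undefined (\<lambda>_. biased_spin q)"

definition sat_prob :: "nat \<Rightarrow> constraint pmf \<Rightarrow> real \<Rightarrow> real" where
  "sat_prob k p q = measure_pmf.prob (pair_pmf p (biased_cube k q)) {(\<phi>, \<sigma>). \<phi> \<sigma> = 1}"

definition balance_dominated :: "nat \<Rightarrow> constraint pmf \<Rightarrow> bool" where
  "balance_dominated k p \<longleftrightarrow> (\<forall>q\<in>{0..1}. sat_prob k p q \<le> sat_prob k p (1/2))"

definition essential :: "nat \<Rightarrow> constraint \<Rightarrow> (nat \<Rightarrow> real) \<Rightarrow> nat \<Rightarrow> bool" where
  "essential k \<phi> \<sigma> i \<longleftrightarrow> \<sigma>(i := - \<sigma> i) \<in> unsat_set k \<phi>"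

definition one_essential :: "nat \<Rightarrow> constraint set \<Rightarrow> bool" where
  "one_essential k \<Phi> \<longleftrightarrow>
     (\<forall>\<phi>\<in>\<Phi>. \<forall>\<sigma>\<in>sat_set k \<phi>. card {i \<in> {1..k}. essential k \<phi> \<sigma> i} \<le> 1)"

definition fourier_coeff :: "nat \<Rightarrow> constraint \<Rightarrow> nat set \<Rightarrow> real" where
  "fourier_coeff k \<phi> Q = (1 / 2 ^ k) * (\<Sum>x\<in>cube k. \<phi> x * (\<Prod>i\<in>Q. x i))"

definition P_poly :: "nat \<Rightarrow> constraint \<Rightarrow> real \<Rightarrow> real" where
  "P_poly k \<phi> \<theta> =
     (\<Sum>Q\<in>Pow {1..k}. (fourier_coeff k \<phi> Q / fourier_coeff k \<phi> {})\<^sup>2 * \<theta> ^ card Q)"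

definition H_fun :: "real \<Rightarrow> real" where
  "H_fun \<theta> = - ((1 + \<theta>) / 2) * ln (1 + \<theta>) - ((1 - \<theta>) / 2) * ln (1 - \<theta>)"

text \<open>
  For non-trivial feasible models the denominator below is positive on \<open>(0,1)\<close>, so the quotients
  are nonnegative and the infimum in the reals is the genuine one.
\<close>

definition r_p :: "nat \<Rightarrow> constraint set \<Rightarrow> constraint pmf \<Rightarrow> real" where
  "r_p k \<Phi> p =
     (INF \<theta>\<in>{0<..<1}. - H_fun \<theta> / (\<Sum>\<phi>\<in>\<Phi>. pmf p \<phi> * ln (P_poly k \<phi> \<theta>)))"

definition Omega_p :: "nat \<Rightarrow> constraint pmf \<Rightarrow> real" where
  "Omega_p k p =
     measure_pmf.expectation p (\<lambda>\<phi>. real (card (unsat_set k \<phi>)) / real (card (sat_set k \<phi>)))"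

end

(* Put s = |S_phi|, m = |I_phi|. Since phi^2 = phi, Parseval gives that the coefficients of P_phi sum
   to 2^k/s = 1 + m/s, and the one at the empty set is 1. By symmetry those at odd |Q| vanish, so
   only |Q| >= 2 remains and ln P_phi(theta) <= P_phi(theta) - 1 <= theta^2 m/s. Together with
   theta^2 <= -2 H(theta) this even yields 0.5/Omega. *)

theory Submission
  imports Defs
begin

text \<open>The left side is the first term of the power series of \<open>- H_fun\<close> at 0,
  whose coefficients are all nonnegative. Instead of the series, the proof uses monotonicity twice:
  \<open>g\<close> is twice the difference of the two sides, and both \<open>g\<close> and its
  derivative \<open>g'\<close> vanish at 0.\<close>

lemma neg_H_fun_ge:
  assumes "0 < \<theta>" "\<theta> < 1"
  shows "\<theta>\<^sup>2 / 2 \<le> - H_fun \<theta>"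
proof -
  define g where "g = (\<lambda>t::real. (1 + t) * ln (1 + t) + (1 - t) * ln (1 - t) - t\<^sup>2)"
  define g' where "g' = (\<lambda>t::real. ln (1 + t) - ln (1 - t) - 2 * t)"
  have g'_nonneg: "0 \<le> g' t" if "0 \<le> t" "t < 1" for t
  proof -
    have "g' 0 \<le> g' t"
    proof (rule DERIV_nonneg_imp_nondecreasing[OF \<open>0 \<le> t\<close>])
      fix u assume u: "0 \<le> u" "u \<le> t"
      then have "u\<^sup>2 < 1" using that by (simp add: power_less_one_iff)
      have "(g' has_real_derivative 1 / (1 + u) + 1 / (1 - u) - 2) (at u)"
        unfolding g'_def using u that by (auto intro!: derivative_eq_intros)
      moreover have "1 / (1 + u) + 1 / (1 - u) - 2 = 2 * u\<^sup>2 / (1 - u\<^sup>2)"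
        using u that \<open>u\<^sup>2 < 1\<close> by (simp add: field_simps power2_eq_square)
      moreover have "2 * u\<^sup>2 / (1 - u\<^sup>2) \<ge> 0" using \<open>u\<^sup>2 < 1\<close> by simp
      ultimately show "\<exists>y. (g' has_real_derivative y) (at u) \<and> 0 \<le> y" by metis
    qed
    then show ?thesis by (simp add: g'_def)
  qed
  have "g 0 \<le> g \<theta>"
  proof (rule DERIV_nonneg_imp_nondecreasing[OF less_imp_le[OF assms(1)]])
    fix u assume u: "0 \<le> u" "u \<le> \<theta>"
    have "(g has_real_derivative g' u) (at u)"
      unfolding g_def g'_def using u assms by (auto intro!: derivative_eq_intros)
    then show "\<exists>y. (g has_real_derivative y) (at u) \<and> 0 \<le> y"
      using g'_nonneg[of u] u assms by auto
  qed
  then show ?thesis by (simp add: g_def H_fun_def field_simps)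
qed

lemma finite_cube [simp]: "finite (cube k)"
  by (auto simp: cube_def intro: finite_PiE)

lemma card_cube: "card (cube k) = 2 ^ k"
  by (simp add: cube_def card_PiE numeral_2_eq_2)

text \<open>Expanding the product of the factors \<open>x i * y i + 1\<close> over the coordinates
  gives exactly the sum over \<open>Q\<close>. On the cube a factor is 2 where \<open>x\<close> and
  \<open>y\<close> agree and 0 where they differ, so a single disagreement kills the
  product.\<close>

lemma cube_characters_orthogonal:
  assumes x: "x \<in> cube k" and y: "y \<in> cube k"
  shows "(\<Sum>Q\<in>Pow {1..k}. (\<Prod>i\<in>Q. x i) * (\<Prod>i\<in>Q. y i)) = (if x = y then 2 ^ k else 0)"
proof -
  have vals: "x i \<in> {-1, 1}" "y i \<in> {-1, 1}" if "i \<in> {1..k}" for i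
    using x y that by (auto simp: cube_def dest!: PiE_mem)
  have "(\<Sum>Q\<in>Pow {1..k}. (\<Prod>i\<in>Q. x i) * (\<Prod>i\<in>Q. y i)) = (\<Prod>i\<in>{1..k}. x i * y i + 1)"
    by (simp add: prod_add prod.distrib)
  also have "\<dots> = (if x = y then 2 ^ k else 0)"
  proof (cases "x = y")
    case True
    then have "(\<Prod>i\<in>{1..k}. x i * y i + 1) = (\<Prod>i\<in>{1..k}. 2)"
      using vals by (intro prod.cong) force+
    then show ?thesis using True by simp
  next
    case False
    then obtain i where i: "i \<in> {1..k}" "x i \<noteq> y i"
      using x y unfolding cube_def by (meson PiE_ext)
    then have "x i * y i + 1 = 0" using vals[of i] by auto
    then show ?thesis using False i by auto
  qed
  finally show ?thesis .
qed

text \<open>Each squared coefficient is a double sum over points \<open>x\<close>, \<open>y\<close>.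
  Summing over \<open>Q\<close> first leaves only the diagonal, with weight \<open>2 ^ k\<close>;
  against the squared normalisation this gives the factor \<open>1 / 2 ^ k\<close>.\<close>

lemma fourier_parseval:
  "(\<Sum>Q\<in>Pow {1..k}. (fourier_coeff k \<phi> Q)\<^sup>2) = (\<Sum>x\<in>cube k. (\<phi> x)\<^sup>2) / 2 ^ k"
proof -
  have "(\<Sum>Q\<in>Pow {1..k}. (\<Sum>x\<in>cube k. \<phi> x * (\<Prod>i\<in>Q. x i))\<^sup>2) =
      (\<Sum>Q\<in>Pow {1..k}. \<Sum>x\<in>cube k. \<Sum>y\<in>cube k.
        \<phi> x * \<phi> y * ((\<Prod>i\<in>Q. x i) * (\<Prod>i\<in>Q. y i)))"
    by (simp add: power2_eq_square sum_product mult_ac)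
  also have "\<dots> = (\<Sum>x\<in>cube k. \<Sum>y\<in>cube k. \<Sum>Q\<in>Pow {1..k}.
        \<phi> x * \<phi> y * ((\<Prod>i\<in>Q. x i) * (\<Prod>i\<in>Q. y i)))"
    by (subst sum.swap, rule sum.cong[OF refl], rule sum.swap)
  also have "\<dots> = (\<Sum>x\<in>cube k. \<Sum>y\<in>cube k. \<phi> x * \<phi> y * (if x = y then 2 ^ k else 0))"
    unfolding sum_distrib_left[symmetric]
    by (intro sum.cong refl arg_cong2[where f = "(*)"] cube_characters_orthogonal)
  also have "\<dots> = (\<Sum>x\<in>cube k. (\<phi> x)\<^sup>2 * 2 ^ k)"
    by (simp add: if_distrib[of "\<lambda>z. _ * z"] power2_eq_square cong: if_cong)
  finally show ?thesis
    by (simp add: fourier_coeff_def power_mult_distrib power_divide power2_eq_square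
        flip: sum_distrib_left sum_distrib_right sum_divide_distrib)
qed

text \<open>Negation is an involution of the cube that preserves \<open>\<phi>\<close> and flips the
  sign of a character of odd degree, so the sum defining the coefficient equals its own
  negative.\<close>

lemma fourier_coeff_odd:
  assumes sym: "\<And>x. x \<in> cube k \<Longrightarrow> \<phi> x = \<phi> (\<lambda>i\<in>{1..k}. - x i)"
    and Q: "Q \<subseteq> {1..k}" and "odd (card Q)"
  shows "fourier_coeff k \<phi> Q = 0"
proof -
  define neg where "neg x = (\<lambda>i\<in>{1..k}. - x i)" for x :: "nat \<Rightarrow> real"
  have neg_cube: "neg x \<in> cube k" if "x \<in> cube k" for x
    using that by (auto simp: neg_def cube_def dest!: PiE_mem)
  have neg_neg: "neg (neg x) = x" if "x \<in> cube k" for x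
    using that by (auto simp: neg_def cube_def fun_eq_iff PiE_def extensional_def)
  have neg_prod: "(\<Prod>i\<in>Q. neg x i) = - (\<Prod>i\<in>Q. x i)" for x
  proof -
    have "(\<Prod>i\<in>Q. neg x i) = (\<Prod>i\<in>Q. - x i)"
      using Q by (intro prod.cong) (auto simp: neg_def)
    then show ?thesis using \<open>odd (card Q)\<close> by (simp add: prod_uminus)
  qed
  have "(\<Sum>x\<in>cube k. \<phi> x * (\<Prod>i\<in>Q. x i)) = (\<Sum>x\<in>cube k. \<phi> (neg x) * (\<Prod>i\<in>Q. neg x i))"
    by (rule sum.reindex_bij_witness[of _ neg neg]) (auto simp: neg_cube neg_neg)
  also have "\<dots> = (\<Sum>x\<in>cube k. - (\<phi> x * (\<Prod>i\<in>Q. x i)))"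
    using sym[folded neg_def] by (intro sum.cong) (simp_all add: neg_prod)
  finally show ?thesis by (simp add: fourier_coeff_def sum_negf)
qed

lemma card_sat_unsat: "card (sat_set k \<phi>) + card (unsat_set k \<phi>) = 2 ^ k"
proof -
  have "sat_set k \<phi> \<subseteq> cube k" by (auto simp: sat_set_def)
  then show ?thesis
    using card_mono[OF finite_cube, of "sat_set k \<phi>" k]
    by (simp add: unsat_set_def card_Diff_subset finite_subset card_cube)
qed

text \<open>The upper bound carries the estimate of the logarithm. The lower bound gives
  \<open>P_poly\<close> at least 1, and more than 1 when \<open>\<rho>\<close> is positive, which
  makes the denominator in \<open>r_p\<close> positive.\<close>

lemma P_poly_bounds:
  assumes \<phi>: "\<phi> \<in> cube k \<rightarrow>\<^sub>E {0, 1}"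
    and sym: "\<And>x. x \<in> cube k \<Longrightarrow> \<phi> x = \<phi> (\<lambda>i\<in>{1..k}. - x i)"
    and sat: "sat_set k \<phi> \<noteq> {}"
    and \<theta>: "0 < \<theta>" "\<theta> < 1"
  defines "\<rho> \<equiv> real (card (unsat_set k \<phi>)) / real (card (sat_set k \<phi>))"
  shows "1 + \<rho> * \<theta> ^ k \<le> P_poly k \<phi> \<theta>" and "P_poly k \<phi> \<theta> \<le> 1 + \<rho> * \<theta>\<^sup>2"
proof -
  define s where "s = real (card (sat_set k \<phi>))"
  define w where "w Q = (fourier_coeff k \<phi> Q / fourier_coeff k \<phi> {})\<^sup>2" for Q
  have "finite (sat_set k \<phi>)" by (rule finite_subset[OF _ finite_cube[of k]]) (auto simp: sat_set_def)
  then have "s > 0" using sat by (simp add: s_def card_gt_0_iff)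
  have vals: "\<phi> x = (if x \<in> sat_set k \<phi> then 1 else 0)" if "x \<in> cube k" for x
    using PiE_mem[OF \<phi> that] that by (auto simp: sat_set_def)
  have sat_Int: "cube k \<inter> sat_set k \<phi> = sat_set k \<phi>" by (auto simp: sat_set_def)
  have s1: "(\<Sum>x\<in>cube k. \<phi> x) = s" and s2: "(\<Sum>x\<in>cube k. (\<phi> x)\<^sup>2) = s"
    by (simp_all add: vals s_def sat_Int if_distrib[of "\<lambda>z. z\<^sup>2"] flip: sum.inter_restrict cong: if_cong)
  have c0: "fourier_coeff k \<phi> {} = s / 2 ^ k" using s1 by (simp add: fourier_coeff_def)
  \<comment> \<open>Parseval gives the numerator \<open>s / 2 ^ k\<close>, because
    \<open>\<phi>\<close> takes only the values 0 and 1 and so equals its square; the denominator is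
    the squared coefficient at \<open>{}\<close>.\<close>
  have "(\<Sum>Q\<in>Pow {1..k}. w Q) = (s / 2 ^ k) / (s / 2 ^ k)\<^sup>2"
    unfolding w_def power_divide sum_divide_distrib[symmetric] fourier_parseval s2 c0 ..
  also have "\<dots> = 2 ^ k / s" using \<open>s > 0\<close> by (simp add: power2_eq_square)
  also have "\<dots> = 1 + \<rho>"
  proof -
    have "s + real (card (unsat_set k \<phi>)) = 2 ^ k"
      unfolding s_def using card_sat_unsat[of k \<phi>] by (metis of_nat_add of_nat_numeral of_nat_power)
    then show ?thesis using \<open>s > 0\<close> by (simp add: \<rho>_def s_def[symmetric] field_simps)
  qed
  finally have total: "(\<Sum>Q\<in>Pow {1..k}. w Q) = 1 + \<rho>" .
  have w0: "w {} = 1" using c0 \<open>s > 0\<close> by (simp add: w_def)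
  let ?R = "Pow {1..k} - {{}}"
  have rest: "(\<Sum>Q\<in>?R. w Q) = \<rho>"
    using total by (simp add: sum_diff1 w0)
  have P: "P_poly k \<phi> \<theta> = 1 + (\<Sum>Q\<in>?R. w Q * \<theta> ^ card Q)"
    by (simp add: P_poly_def sum_diff1 w0 flip: w_def)
  have w_nonneg: "w Q \<ge> 0" for Q by (simp add: w_def)
  \<comment> \<open>For \<open>\<theta>\<close> in (0,1) higher powers are smaller, and
    \<open>k\<close> is the largest degree that occurs.\<close>
  have "(\<Sum>Q\<in>?R. w Q * \<theta> ^ k) \<le> (\<Sum>Q\<in>?R. w Q * \<theta> ^ card Q)"
  proof (rule sum_mono)
    fix Q assume "Q \<in> ?R"
    then have "card Q \<le> k" using card_mono[of "{1..k}" Q] by auto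
    then show "w Q * \<theta> ^ k \<le> w Q * \<theta> ^ card Q"
      using \<theta> by (intro mult_left_mono power_decreasing w_nonneg) auto
  qed
  then show "1 + \<rho> * \<theta> ^ k \<le> P_poly k \<phi> \<theta>"
    unfolding P sum_distrib_right[symmetric] rest by simp
  have "(\<Sum>Q\<in>?R. w Q * \<theta> ^ card Q) \<le> (\<Sum>Q\<in>?R. w Q * \<theta>\<^sup>2)"
  proof (rule sum_mono)
    fix Q assume Q: "Q \<in> ?R"
    show "w Q * \<theta> ^ card Q \<le> w Q * \<theta>\<^sup>2"
    proof (cases "odd (card Q)")
      case True
      then show ?thesis using fourier_coeff_odd[of k \<phi> Q, OF sym] Q by (simp add: w_def)
    next
      case False
      have "finite Q" using Q finite_subset[of Q "{1..k}"] by auto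
      then have "card Q \<noteq> 0" using Q by auto
      then have "2 \<le> card Q" using False by (cases "card Q = 1") auto
      then show ?thesis
        using \<theta> by (intro mult_left_mono power_decreasing w_nonneg) auto
    qed
  qed
  then show "P_poly k \<phi> \<theta> \<le> 1 + \<rho> * \<theta>\<^sup>2"
    unfolding P sum_distrib_right[symmetric] rest by simp
qed

theorem theorem8p1:
  fixes k :: nat and \<Phi> :: "constraint set" and p :: "constraint pmf"
  assumes "csp_model k \<Phi> p"
    and "nontrivial k \<Phi>"
    and "feasible k \<Phi>"
    and "symmetric k \<Phi>"
    and "balance_dominated k p"
    and "one_essential k \<Phi>"
  shows "r_p k \<Phi> p \<ge> 0.25 / Omega_p k p"
proof -
  define \<rho> where "\<rho> = (\<lambda>\<phi>. real (card (unsat_set k \<phi>)) / real (card (sat_set k \<phi>)))"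
  have k: "1 \<in> {1..k}" and \<Phi>: "\<Phi> \<subseteq> cube k \<rightarrow>\<^sub>E {0, 1}" and supp: "set_pmf p = \<Phi>"
    using assms(1) by (auto simp: csp_model_def)
  have "finite \<Phi>" by (rule finite_subset[OF \<Phi>]) (auto intro: finite_PiE)
  have one: "(\<lambda>i\<in>{1..k}. 1) \<in> cube k" by (auto simp: cube_def)
  have sat: "sat_set k \<phi> \<noteq> {}" if \<phi>: "\<phi> \<in> \<Phi>" for \<phi>
  proof -
    \<comment> \<open>Feasibility with coordinate 1 left free and all others set to 1 yields a
      satisfying point, so no division by an empty \<open>sat_set\<close> occurs.\<close>
    from assms(3) \<phi> k one obtain s where s: "s \<in> {-1, 1}" "\<phi> ((\<lambda>i\<in>{1..k}. 1)(1 := s)) = 1"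
      unfolding feasible_def by blast
    moreover have "(\<lambda>i\<in>{1..k}. 1)(1 := s) \<in> cube k"
      using s k by (auto simp: cube_def PiE_def extensional_def)
    ultimately show ?thesis by (auto simp: sat_set_def)
  qed
  have pos: "pmf p \<phi> > 0" if "\<phi> \<in> \<Phi>" for \<phi> using that supp by (simp add: pmf_positive)
  have \<rho>_nonneg: "\<rho> \<phi> \<ge> 0" for \<phi> by (simp add: \<rho>_def)
  \<comment> \<open>A constraint violated at the all-ones point has positive \<open>\<rho>\<close>.
    This one constraint makes both \<open>Omega_p\<close> and the denominator \<open>?D\<close>
    strictly positive.\<close>
  obtain \<psi> where \<psi>: "\<psi> \<in> \<Phi>" "\<psi> (\<lambda>i\<in>{1..k}. 1) = 0"
    using assms(2) by (auto simp: nontrivial_def)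
  have "(\<lambda>i\<in>{1..k}. 1) \<in> unsat_set k \<psi>" using one \<psi> by (simp add: unsat_set_def sat_set_def)
  then have "card (unsat_set k \<psi>) > 0"
    by (auto simp: card_gt_0_iff unsat_set_def)
  moreover have "card (sat_set k \<psi>) > 0"
    using sat[OF \<psi>(1)] by (auto simp: card_gt_0_iff sat_set_def)
  ultimately have \<rho>_pos: "\<rho> \<psi> > 0" by (simp add: \<rho>_def)
  have \<Omega>: "Omega_p k p = (\<Sum>\<phi>\<in>\<Phi>. pmf p \<phi> * \<rho> \<phi>)"
    unfolding Omega_p_def \<rho>_def using \<open>finite \<Phi>\<close> supp
    by (subst integral_measure_pmf_real[of \<Phi>]) (auto simp: mult.commute)
  have \<Omega>_pos: "Omega_p k p > 0" unfolding \<Omega>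
    using \<open>finite \<Phi>\<close> \<psi>(1) pos \<rho>_nonneg \<rho>_pos
    by (intro sum_pos2[of _ \<psi>]) (auto intro!: mult_nonneg_nonneg)
  show ?thesis unfolding r_p_def
  \<comment> \<open>It suffices to bound the quotient at every \<open>\<theta>\<close>; the index
    set must be nonempty for the real infimum to be meaningful.\<close>
  proof (rule cINF_greatest)
    show "{0<..<1::real} \<noteq> {}" by simp
  next
    fix \<theta> :: real assume "\<theta> \<in> {0<..<1}"
    then have \<theta>: "0 < \<theta>" "\<theta> < 1" by auto
    let ?D = "\<Sum>\<phi>\<in>\<Phi>. pmf p \<phi> * ln (P_poly k \<phi> \<theta>)"
    have bnd: "1 + \<rho> \<phi> * \<theta> ^ k \<le> P_poly k \<phi> \<theta>" "P_poly k \<phi> \<theta> \<le> 1 + \<rho> \<phi> * \<theta>\<^sup>2"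
      if "\<phi> \<in> \<Phi>" for \<phi>
      using P_poly_bounds[of \<phi> k \<theta>] that \<Phi> assms(4) sat[OF that] \<theta>
      unfolding \<rho>_def symmetric_def by blast+
    have ge1: "1 \<le> P_poly k \<phi> \<theta>" if "\<phi> \<in> \<Phi>" for \<phi>
    proof -
      have "0 \<le> \<rho> \<phi> * \<theta> ^ k" using \<rho>_nonneg \<theta> by simp
      then show ?thesis using bnd(1)[OF that] by linarith
    qed
    have "0 < \<rho> \<psi> * \<theta> ^ k" using \<rho>_pos \<theta> by simp
    then have "1 < P_poly k \<psi> \<theta>" using bnd(1)[OF \<psi>(1)] by linarith
    then have D_pos: "?D > 0"
      using \<open>finite \<Phi>\<close> \<psi>(1) pos ge1 by (intro sum_pos2[of _ \<psi>]) auto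
    \<comment> \<open>The inequality \<open>ln z \<le> z - 1\<close> makes the bound linear in
      \<open>\<rho> \<phi>\<close>, so that averaging over \<open>p\<close> produces
      \<open>Omega_p\<close>.\<close>
    have "?D \<le> (\<Sum>\<phi>\<in>\<Phi>. pmf p \<phi> * (\<rho> \<phi> * \<theta>\<^sup>2))"
    proof (intro sum_mono mult_left_mono)
      fix \<phi> assume "\<phi> \<in> \<Phi>"
      then show "ln (P_poly k \<phi> \<theta>) \<le> \<rho> \<phi> * \<theta>\<^sup>2"
        using ge1 bnd(2) ln_le_minus_one[of "P_poly k \<phi> \<theta>"] by fastforce
    qed auto
    also have "\<dots> = Omega_p k p * \<theta>\<^sup>2" by (simp add: \<Omega> sum_distrib_right mult.assoc)
    also have "\<dots> \<le> Omega_p k p * (2 * - H_fun \<theta>)"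
      using neg_H_fun_ge[OF \<theta>] \<Omega>_pos by (intro mult_left_mono) auto
    finally have "?D / 2 \<le> - H_fun \<theta> * Omega_p k p" by (simp add: mult_ac)
    \<comment> \<open>The constant 1/2 is weakened to the stated 1/4, which is sound because
      \<open>?D\<close> is positive.\<close>
    then have "0.25 * ?D \<le> - H_fun \<theta> * Omega_p k p" using D_pos by simp
    then show "0.25 / Omega_p k p \<le> - H_fun \<theta> / ?D"
      using \<Omega>_pos D_pos by (subst frac_le_eq[THEN iffD2]; simp add: field_simps)
  qed
qed

end
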